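(* For every integer $Q\ge1$ there exists $c_Q>0$ (depending only on $Q$) such that for every pointed metric space $(Y,y_0)$ and every $v,v'\in\mathcal{Q}_Q(Y)$ one has $$c_Q\,\mathcal{G}_1(v,v')\le\|\zeta(v)-\zeta(v')\|_{(\mathrm{Lip}\,Y)^*}\le\mathcal{G}_1(v,v').$$
   Context: A pointed metric space $(Y,y_0)$ is a metric space $(Y,d)$ with a distinguished point $y_0\in Y$. $\mathcal{Q}_Q(Y)$ is the quotient of $Y^Q$ by the permutation action of the symmetric group $S_Q$; the class of $(y_1,\dots,y_Q)$ is $[\![y_1,\dots,y_Q]\!]$; $\mathcal{G}_1([\![y_1,\dots,y_Q]\!],[\![y_1',\dots,y_Q']\!])=\min_{\sigma\in S_Q}\sum_{i=1}^Q d(y_i,y'_{\sigma(i)})$. $\mathrm{Lip}_{y_0}(Y)$ is the Banach space of Lipschitz functions $u:Y\to\mathbb{R}$ with $u(y_0)=0$, with norm $\|u\|_{\mathrm{Lip}}=\mathrm{Lip}\,u$; $\|\cdot\|_{(\mathrm{Lip}\,Y)^*}$ is the dual norm on $\mathrm{Lip}_{y_0}(Y)^*$. The map $\zeta:\mathcal{Q}_Q(Y)\to\mathrm{Lip}_{y_0}(Y)^*$ is defined by $\zeta([\![y_1,\dots,y_Q]\!])(u)=\sum_{i=1}^Q u(y_i)$. *)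

theory Defs
  imports "HOL-Analysis.Analysis"
begin

section \<open>Unordered tuples\<close>

definition tuples :: "nat \<Rightarrow> 'a metric \<Rightarrow> (nat \<Rightarrow> 'a) set" where
  "tuples Q Y = {1..Q} \<rightarrow>\<^sub>E mspace Y"

definition perm_rel :: "nat \<Rightarrow> 'a metric \<Rightarrow> ((nat \<Rightarrow> 'a) \<times> (nat \<Rightarrow> 'a)) set" where
  "perm_rel Q Y =
     {(y, y'). y \<in> tuples Q Y \<and> y' \<in> tuples Q Y \<and> (\<exists>\<sigma>. \<sigma> permutes {1..Q} \<and> y' = y \<circ> \<sigma>)}"

definition unordered_tuples :: "nat \<Rightarrow> 'a metric \<Rightarrow> (nat \<Rightarrow> 'a) set set" where
  "unordered_tuples Q Y = tuples Q Y // perm_rel Q Y"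

text \<open>
  The minimum below also ranges over the representatives of both classes. This does not change its
  value, see \<open>G1_class\<close>.
\<close>

definition G1 :: "nat \<Rightarrow> 'a metric \<Rightarrow> (nat \<Rightarrow> 'a) set \<Rightarrow> (nat \<Rightarrow> 'a) set \<Rightarrow> real" where
  "G1 Q Y v v' =
     Min {\<Sum>i=1..Q. mdist Y (y i) (y' (\<sigma> i)) | y y' \<sigma>. y \<in> v \<and> y' \<in> v' \<and> \<sigma> permutes {1..Q}}"

section \<open>Lipschitz functions and the dual norm\<close>

text \<open>
  A function on the points of \<open>Y\<close> is represented by its extension by zero to the whole type, so that
  \<open>Lip0 Y y0\<close> is a linear space under pointwise operations.
\<close>

definition Lip0 :: "'a metric \<Rightarrow> 'a \<Rightarrow> ('a \<Rightarrow> real) set" where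
  "Lip0 Y y0 =
     {u. Lipschitz_continuous_map Y euclidean_metric u \<and> u y0 = 0 \<and> (\<forall>x. x \<notin> mspace Y \<longrightarrow> u x = 0)}"

definition Lip_const :: "'a metric \<Rightarrow> ('a \<Rightarrow> real) \<Rightarrow> real" where
  "Lip_const Y u =
     Inf {L. 0 \<le> L \<and> (\<forall>x \<in> mspace Y. \<forall>y \<in> mspace Y. \<bar>u x - u y\<bar> \<le> L * mdist Y x y)}"

text \<open>
  This is the operator norm for bounded functionals on \<open>Lip0 Y y0\<close>; all functionals it is applied
  to are bounded by \<open>bdd_above_zeta_diff\<close>.
\<close>

definition Lip_dual_norm :: "'a metric \<Rightarrow> 'a \<Rightarrow> (('a \<Rightarrow> real) \<Rightarrow> real) \<Rightarrow> real" where
  "Lip_dual_norm Y y0 \<phi> = Sup {\<bar>\<phi> u\<bar> | u. u \<in> Lip0 Y y0 \<and> Lip_const Y u \<le> 1}"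

definition zeta :: "nat \<Rightarrow> (nat \<Rightarrow> 'a) set \<Rightarrow> ('a \<Rightarrow> real) \<Rightarrow> real" where
  "zeta Q v u = (THE s. \<exists>y \<in> v. s = (\<Sum>i=1..Q. u (y i)))"

section \<open>The constant\<close>

text \<open>
  HOL cannot quantify over types inside a formula: with \<open>Y\<close> ranging over \<open>'a metric\<close>, a statement
  \<open>\<exists>c > 0. \<forall>Y. \<dots>\<close> would let \<open>c\<close> depend on \<open>'a\<close>. The constant is therefore a closed term
  depending on \<open>Q\<close> only, and the theorem asserts that it works for every type \<open>'a\<close>. It is
  an arbitrary constant working for the metric spaces whose points are natural numbers; these
  suffice to single it out because the estimate concerns at most \<open>2 * Q + 1\<close> points at a time.
\<close>

definition c_const :: "nat \<Rightarrow> real" where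
  "c_const Q = (SOME c. 0 < c \<and>
     (\<forall>(Y :: nat metric) y0 v v'.
        y0 \<in> mspace Y \<longrightarrow> v \<in> unordered_tuples Q Y \<longrightarrow> v' \<in> unordered_tuples Q Y \<longrightarrow>
          c * G1 Q Y v v' \<le> Lip_dual_norm Y y0 (zeta Q v - zeta Q v') \<and>
          Lip_dual_norm Y y0 (zeta Q v - zeta Q v') \<le> G1 Q Y v v'))"

section \<open>Well-definedness\<close>

lemma tuples_comp:
  assumes "y \<in> tuples Q Y" "\<sigma> permutes {1..Q}"
  shows "y \<circ> \<sigma> \<in> tuples Q Y"
proof -
  have "\<sigma> i \<in> {1..Q} \<longleftrightarrow> i \<in> {1..Q}" for i
    using assms(2) by (rule permutes_in_image)
  then show ?thesis
    using assms(1) unfolding tuples_def PiE_iff extensional_def mem_Collect_eq o_apply by blast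
qed

lemma equiv_perm_rel: "equiv (tuples Q Y) (perm_rel Q Y)"
proof (rule equivI)
  show "perm_rel Q Y \<subseteq> tuples Q Y \<times> tuples Q Y"
    by (auto simp: perm_rel_def)
  show "refl_on (tuples Q Y) (perm_rel Q Y)"
    by (auto simp: perm_rel_def refl_on_def intro!: exI[of _ id] permutes_id)
  show "sym (perm_rel Q Y)"
  proof (rule symI)
    fix y y' assume "(y, y') \<in> perm_rel Q Y"
    then obtain \<sigma> where s: "\<sigma> permutes {1..Q}" "y' = y \<circ> \<sigma>" "y \<in> tuples Q Y" "y' \<in> tuples Q Y"
      by (auto simp: perm_rel_def)
    then have "y = y' \<circ> inv \<sigma>"
      by (simp add: comp_assoc permutes_inv_o)
    with s show "(y', y) \<in> perm_rel Q Y"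
      using permutes_inv[OF s(1)] by (auto simp: perm_rel_def)
  qed
  show "trans (perm_rel Q Y)"
    by (rule transI) (auto simp: perm_rel_def comp_assoc intro: permutes_compose)
qed

lemma class_eq:
  assumes "y \<in> tuples Q Y"
  shows "perm_rel Q Y `` {y} = {y \<circ> \<sigma> | \<sigma>. \<sigma> permutes {1..Q}}"
  using assms tuples_comp[OF assms] by (auto simp: perm_rel_def)

lemma zeta_class:
  assumes "y \<in> tuples Q Y"
  shows "zeta Q (perm_rel Q Y `` {y}) u = (\<Sum>i=1..Q. u (y i))"
proof -
  have inv: "(\<Sum>i=1..Q. u ((y \<circ> \<sigma>) i)) = (\<Sum>i=1..Q. u (y i))" if "\<sigma> permutes {1..Q}" for \<sigma>
    using sum.permute[OF that, of "\<lambda>i. u (y i)"] by (simp add: o_def)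
  show ?thesis
    unfolding zeta_def class_eq[OF assms]
  proof (rule the_equality)
    show "\<exists>y'\<in>{y \<circ> \<sigma> |\<sigma>. \<sigma> permutes {1..Q}}. (\<Sum>i=1..Q. u (y i)) = (\<Sum>i=1..Q. u (y' i))"
      using permutes_id[of "{1..Q}"] by (intro bexI[of _ y]) (auto intro!: exI[of _ id])
  next
    fix s assume "\<exists>y'\<in>{y \<circ> \<sigma> |\<sigma>. \<sigma> permutes {1..Q}}. s = (\<Sum>i=1..Q. u (y' i))"
    then show "s = (\<Sum>i=1..Q. u (y i))" using inv by blast
  qed
qed

lemma G1_class:
  assumes "y \<in> tuples Q Y" "y' \<in> tuples Q Y"
  shows "G1 Q Y (perm_rel Q Y `` {y}) (perm_rel Q Y `` {y'}) =
         Min {\<Sum>i=1..Q. mdist Y (y i) (y' (\<sigma> i)) | \<sigma>. \<sigma> permutes {1..Q}}"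
proof -
  let ?S = "\<lambda>y y' \<sigma>. \<Sum>i=1..Q. mdist Y (y i) (y' (\<sigma> i))"
  have eq: "?S (y \<circ> \<tau>) (y' \<circ> \<tau>') \<sigma> = ?S y y' (\<tau>' \<circ> \<sigma> \<circ> inv \<tau>)" if "\<tau> permutes {1..Q}" for \<tau> \<tau>' \<sigma>
    using sum.permute[OF that, of "\<lambda>i. mdist Y (y i) (y' (\<tau>' (\<sigma> (inv \<tau> i))))"]
    by (simp add: o_def permutes_inverses(2)[OF that])
  have sub: "\<exists>\<rho>. ?S (y \<circ> \<tau>) (y' \<circ> \<tau>') \<sigma> = ?S y y' \<rho> \<and> \<rho> permutes {1..Q}"
    if "\<tau> permutes {1..Q}" "\<tau>' permutes {1..Q}" "\<sigma> permutes {1..Q}" for \<tau> \<tau>' \<sigma>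
    using that eq[OF that(1)] by (intro exI[of _ "\<tau>' \<circ> \<sigma> \<circ> inv \<tau>"]) (auto intro: permutes_compose permutes_inv)
  have "{?S z z' \<sigma> | z z' \<sigma>. z \<in> perm_rel Q Y `` {y} \<and> z' \<in> perm_rel Q Y `` {y'} \<and> \<sigma> permutes {1..Q}}
      = {?S y y' \<sigma> | \<sigma>. \<sigma> permutes {1..Q}}" (is "?A = ?B")
  proof
    show "?A \<subseteq> ?B" unfolding class_eq[OF assms(1)] class_eq[OF assms(2)] using sub by blast
    have "y \<in> perm_rel Q Y `` {y}" "y' \<in> perm_rel Q Y `` {y'}"
      using equiv_class_self[OF equiv_perm_rel] assms by blast+
    then show "?B \<subseteq> ?A" by blast
  qed
  then show ?thesis by (simp add: G1_def)
qed

lemma Lip0_bound: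
  assumes u: "u \<in> Lip0 Y y0" "Lip_const Y u \<le> 1" and xy: "x \<in> mspace Y" "y \<in> mspace Y"
  shows "\<bar>u x - u y\<bar> \<le> mdist Y x y"
proof (cases "mdist Y x y = 0")
  case True
  then show ?thesis using xy by simp
next
  case False
  then have pos: "0 < mdist Y x y" using mdist_nonneg[of Y x y] by linarith
  let ?L = "{L. 0 \<le> L \<and> (\<forall>x \<in> mspace Y. \<forall>y \<in> mspace Y. \<bar>u x - u y\<bar> \<le> L * mdist Y x y)}"
  obtain B where B: "B > 0" "\<forall>x\<in>mspace Y. \<forall>y\<in>mspace Y. \<bar>u x - u y\<bar> \<le> B * mdist Y x y"
    using u(1) by (auto simp: Lip0_def Lipschitz_continuous_map_pos dist_real_def)
  then have "?L \<noteq> {}" by (auto intro!: exI[of _ B])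
  moreover have "\<bar>u x - u y\<bar> / mdist Y x y \<le> L" if "L \<in> ?L" for L
    using that xy pos by (auto simp: pos_divide_le_eq)
  ultimately have "\<bar>u x - u y\<bar> / mdist Y x y \<le> Lip_const Y u"
    unfolding Lip_const_def by (intro cInf_greatest) auto
  then show ?thesis using u(2) pos by (simp add: pos_divide_le_eq)
      (metis mult_1 mult_le_cancel_right order_trans less_imp_le not_less)
qed

lemma bdd_above_zeta_diff:
  assumes "v \<in> unordered_tuples Q Y" "v' \<in> unordered_tuples Q Y"
  shows "bdd_above {\<bar>(zeta Q v - zeta Q v') u\<bar> | u. u \<in> Lip0 Y y0 \<and> Lip_const Y u \<le> 1}"
proof -
  obtain y y' where y: "y \<in> tuples Q Y" "v = perm_rel Q Y `` {y}"
    and y': "y' \<in> tuples Q Y" "v' = perm_rel Q Y `` {y'}"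
    using assms by (auto simp: unordered_tuples_def quotient_def)
  have "\<bar>(zeta Q v - zeta Q v') u\<bar> \<le> (\<Sum>i=1..Q. mdist Y (y i) (y' i))"
    if u: "u \<in> Lip0 Y y0" "Lip_const Y u \<le> 1" for u
  proof -
    have "(zeta Q v - zeta Q v') u = (\<Sum>i=1..Q. u (y i) - u (y' i))"
      by (simp add: y y' zeta_class sum_subtractf)
    also have "\<bar>\<dots>\<bar> \<le> (\<Sum>i=1..Q. \<bar>u (y i) - u (y' i)\<bar>)" by (rule sum_abs)
    also have "\<dots> \<le> (\<Sum>i=1..Q. mdist Y (y i) (y' i))"
      using y(1) y'(1) by (intro sum_mono Lip0_bound[OF u]) (auto simp: tuples_def PiE_iff)
    finally show ?thesis .
  qed
  then show ?thesis by (auto intro!: bdd_aboveI)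
qed

end

theory Submission
  imports Defs
begin

text \<open>
  The Kantorovich duality theorem for finite assignments gives equality with constant 1. If the
  identity is an optimal matching of \<open>y\<close> and \<open>y'\<close>, then the gain \<open>w i j = d (y i) (y' j) - d (y i) (y' i)\<close>
  of rematching has nonnegative sum along every closed walk, so the shortest walk length to a fixed
  root is a potential \<open>\<phi>\<close> with \<open>\<phi> i \<le> w i j + \<phi> j\<close>. The 1-Lipschitz function
  \<open>x \<mapsto> min\<^sub>j (\<phi> j + d x (y' j))\<close> then drops by at least \<open>d (y i) (y' i)\<close> from \<open>y i\<close> to \<open>y' i\<close>.
  Consequently every admissible constant is at most 1, in particular the chosen one.
\<close>

section \<open>Potentials\<close>

fun walk_cost :: "('i \<Rightarrow> 'i \<Rightarrow> real) \<Rightarrow> 'i list \<Rightarrow> real" where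
  "walk_cost w (a # b # p) = w a b + walk_cost w (b # p)"
| "walk_cost w _ = 0"

lemma walk_cost_Cons: "p \<noteq> [] \<Longrightarrow> walk_cost w (a # p) = w a (hd p) + walk_cost w p"
  by (cases p) auto

text \<open>The cut vertex \<open>a\<close> is kept in both pieces, as the end of the first and the
  start of the second, so no edge is lost.\<close>

lemma walk_cost_append: "walk_cost w (p @ a # q) = walk_cost w (p @ [a]) + walk_cost w (a # q)"
  by (induction w p rule: walk_cost.induct) (auto simp: walk_cost_Cons)

text \<open>The permutation is the cyclic shift along \<open>p\<close>, so its edges are those of
  the closed walk. The clause on \<open>last p\<close> identifies the closing edge, which the
  induction step replaces by two edges through the new vertex.\<close>

lemma cycle_permutation:
  assumes "p \<noteq> []" "distinct p"
  shows "\<exists>\<sigma>. \<sigma> permutes set p \<and> \<sigma> (last p) = hd p \<and>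
    (\<Sum>i\<in>set p. w i (\<sigma> i)) = walk_cost w (p @ [hd p])"
  using assms
proof (induction p)
  case Nil
  then show ?case by simp
next
  case (Cons a p)
  show ?case
  proof (cases "p = []")
    case True
    then show ?thesis by (intro exI[of _ id]) (auto simp: permutes_id)
  next
    case False
    obtain \<sigma> where s: "\<sigma> permutes set p" "\<sigma> (last p) = hd p"
      and cost: "(\<Sum>i\<in>set p. w i (\<sigma> i)) = walk_cost w (p @ [hd p])"
      using Cons False by auto
    \<comment> \<open>The transposition inserts \<open>a\<close> into the cycle:
      \<open>last p\<close> now goes to \<open>a\<close>, \<open>a\<close> goes to
      \<open>hd p\<close>, and all other vertices keep their images.\<close>
    define \<tau> where "\<tau> = Transposition.transpose a (hd p) \<circ> \<sigma>"
    have a: "a \<notin> set p" using Cons.prems by simp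
    have tau_perm: "\<tau> permutes set (a # p)"
      unfolding \<tau>_def using False
      by (intro permutes_compose permutes_subset[OF s(1)] permutes_swap_id) auto
    have tau_a: "\<tau> a = hd p"
      using permutes_not_in[OF s(1) a] by (simp add: \<tau>_def)
    have tau_last: "\<tau> (last p) = a" by (simp add: \<tau>_def s)
    have tau: "\<tau> i = \<sigma> i" if "i \<in> set p - {last p}" for i
    proof -
      have "\<sigma> i \<noteq> hd p" using that s permutes_inj[OF s(1)] by (metis DiffE injD singletonI)
      moreover have "\<sigma> i \<noteq> a" using that a permutes_in_image[OF s(1), of i] by auto
      ultimately show ?thesis by (simp add: \<tau>_def)
    qed
    have split: "(\<Sum>i\<in>set p. f i) = f (last p) + (\<Sum>i\<in>set p - {last p}. f i)" for f :: "'a \<Rightarrow> real"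
      using False by (intro sum.remove) auto
    have snoc: "walk_cost w (p @ [b]) = walk_cost w p + w (last p) b" for b
    proof -
      have "walk_cost w ((butlast p @ [last p]) @ [b]) = walk_cost w (butlast p @ [last p]) + w (last p) b"
        using walk_cost_append[of w "butlast p" "last p" "[b]"] by simp
      then show ?thesis unfolding append_butlast_last_id[OF False] .
    qed
    have "(\<Sum>i\<in>set (a # p). w i (\<tau> i)) =
        w a (hd p) + (w (last p) a + (\<Sum>i\<in>set p - {last p}. w i (\<sigma> i)))"
    proof -
      have "(\<Sum>i\<in>set p - {last p}. w i (\<tau> i)) = (\<Sum>i\<in>set p - {last p}. w i (\<sigma> i))"
        by (rule sum.cong) (simp_all only: tau)
      then show ?thesis using a by (simp add: tau_a split[of "\<lambda>i. w i (\<tau> i)"] tau_last)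
    qed
    \<comment> \<open>Dropping the old closing edge from \<open>last p\<close> to
      \<open>hd p\<close> leaves the open walk \<open>p\<close>.\<close>
    also have "(\<Sum>i\<in>set p - {last p}. w i (\<sigma> i)) = walk_cost w p"
      using cost split[of "\<lambda>i. w i (\<sigma> i)"] snoc[of "hd p"] s(2) by simp
    finally have "(\<Sum>i\<in>set (a # p). w i (\<tau> i)) = walk_cost w ((a # p) @ [hd (a # p)])"
      using False by (simp add: walk_cost_Cons snoc)
    then show ?thesis using tau_perm tau_last False by (intro exI[of _ \<tau>]) simp
  qed
qed

text \<open>A closed walk without repetitions is a cycle, covered by the hypothesis on permutations.
  At a repeated vertex the walk splits into two shorter closed walks whose costs add up.\<close>

lemma closed_walk_cost_nonneg:
  assumes "finite S" and diag: "\<And>i. i \<in> S \<Longrightarrow> w i i = 0"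
    and perm: "\<And>\<sigma>. \<sigma> permutes S \<Longrightarrow> 0 \<le> (\<Sum>i\<in>S. w i (\<sigma> i))"
    and "p \<noteq> []" "set p \<subseteq> S"
  shows "0 \<le> walk_cost w (p @ [hd p])"
  using assms(4,5)
proof (induction p rule: length_induct)
  case (1 p)
  show ?case
  proof (cases "distinct p")
    case True
    then obtain \<sigma> where s: "\<sigma> permutes set p" "(\<Sum>i\<in>set p. w i (\<sigma> i)) = walk_cost w (p @ [hd p])"
      using cycle_permutation[of p w] 1 by blast
    \<comment> \<open>Points of \<open>S\<close> off the cycle are fixed by \<sigma> and contribute
      \<open>w i i = 0\<close>.\<close>
    have "(\<Sum>i\<in>S. w i (\<sigma> i)) = (\<Sum>i\<in>set p. w i (\<sigma> i))"
      using 1 assms(1) diag by (intro sum.mono_neutral_right) (auto simp: permutes_not_in[OF s(1)])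
    then show ?thesis using perm[OF permutes_subset[OF s(1)]] 1 s(2) by simp
  next
    case False
    then obtain xs ys zs a where p: "p = xs @ [a] @ ys @ [a] @ zs"
      using not_distinct_decomp by blast
    have "0 \<le> walk_cost w ((a # ys) @ [hd (a # ys)])"
      using 1 p by (intro 1(1)[rule_format]) auto
    moreover have "0 \<le> walk_cost w ((xs @ a # zs) @ [hd (xs @ a # zs)])"
      using 1 p by (intro 1(1)[rule_format]) auto
    \<comment> \<open>Excising the loop keeps the starting vertex, also when \<open>xs\<close> is
      empty and this vertex is \<open>a\<close>.\<close>
    moreover have "hd p = hd (xs @ a # zs)" by (cases xs) (auto simp: p)
    ultimately show ?thesis
      using walk_cost_append[of w xs a "ys @ a # zs @ [hd p]"]
        walk_cost_append[of w "a # ys" a "zs @ [hd p]"] walk_cost_append[of w xs a "zs @ [hd p]"]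
      by (simp add: p)
  qed
qed

lemma potential_exists:
  assumes "finite S" "\<And>i. i \<in> S \<Longrightarrow> w i i = 0"
    and "\<And>\<sigma>. \<sigma> permutes S \<Longrightarrow> 0 \<le> (\<Sum>i\<in>S. w i (\<sigma> i))"
  obtains \<phi> :: "'i \<Rightarrow> real" where "\<And>i j. i \<in> S \<Longrightarrow> j \<in> S \<Longrightarrow> \<phi> i \<le> w i j + \<phi> j"
proof (cases "S = {}")
  case True
  then show ?thesis using that by simp
next
  case False
  then obtain r where r: "r \<in> S" by blast
  \<comment> \<open>Costs of all walks from \<open>i\<close> to the root. Vertices may be revisited,
    so this set can be infinite and an infimum replaces the minimum.\<close>
  define W where "W i = {walk_cost w (i # p @ [r]) | p. set p \<subseteq> S}" for i
  have ne: "W i \<noteq> {}" for i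
    using empty_subsetI[of S] unfolding W_def by (metis (mono_tags, lifting) empty_Collect_eq empty_set)
  have bdd: "bdd_below (W i)" if i: "i \<in> S" for i
  proof (rule bdd_belowI)
    fix c assume "c \<in> W i"
    then obtain p where p: "set p \<subseteq> S" "c = walk_cost w (i # p @ [r])" by (auto simp: W_def)
    \<comment> \<open>Returning from \<open>r\<close> to \<open>i\<close> closes the walk at the
      extra cost \<open>w r i\<close>, which bounds all costs from below.\<close>
    have "0 \<le> walk_cost w ((i # p @ [r]) @ [hd (i # p @ [r])])"
      by (rule closed_walk_cost_nonneg[of S]) (use assms p i r in auto)
    then show "- w r i \<le> c"
      using walk_cost_append[of w "i # p" r "[i]"] p by simp
  qed
  have "Inf (W i) \<le> w i j + Inf (W j)" if ij: "i \<in> S" "j \<in> S" for i j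
  proof -
    have "Inf (W i) - w i j \<le> c" if "c \<in> W j" for c
    proof -
      obtain p where p: "set p \<subseteq> S" "c = walk_cost w (j # p @ [r])"
        using \<open>c \<in> W j\<close> by (auto simp: W_def)
      \<comment> \<open>Prefixing the edge from \<open>i\<close> to \<open>j\<close> turns a walk
        from \<open>j\<close> into one from \<open>i\<close>.\<close>
      have "walk_cost w (i # (j # p) @ [r]) \<in> W i"
        unfolding W_def using p ij by (intro CollectI exI[of _ "j # p"]) auto
      from cInf_lower[OF this bdd[OF ij(1)]] show ?thesis by (simp add: p)
    qed
    then have "Inf (W i) - w i j \<le> Inf (W j)" by (rule cInf_greatest[OF ne])
    then show ?thesis by simp
  qed
  then show ?thesis using that[of "\<lambda>i. Inf (W i)"] by blast
qed

section \<open>Duality\<close>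

text \<open>Optimality of the identity is exactly the permutation hypothesis of
  \<open>potential_exists\<close> for the rematching gain. The base point is ignored here; a
  constant is subtracted later.\<close>

lemma matching_potential:
  assumes "finite S" "S \<noteq> {}" and y: "\<And>i. i \<in> S \<Longrightarrow> y i \<in> mspace Y"
    and y': "\<And>i. i \<in> S \<Longrightarrow> y' i \<in> mspace Y"
    and opt: "\<And>\<sigma>. \<sigma> permutes S \<Longrightarrow> (\<Sum>i\<in>S. mdist Y (y i) (y' i)) \<le> (\<Sum>i\<in>S. mdist Y (y i) (y' (\<sigma> i)))"
  obtains g where "\<And>a b. a \<in> mspace Y \<Longrightarrow> b \<in> mspace Y \<Longrightarrow> \<bar>g a - g b\<bar> \<le> mdist Y a b"
    and "\<And>i. i \<in> S \<Longrightarrow> mdist Y (y i) (y' i) \<le> g (y i) - g (y' i)"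
proof -
  obtain \<phi> where \<phi>: "\<And>i j. i \<in> S \<Longrightarrow> j \<in> S \<Longrightarrow> \<phi> i \<le> (mdist Y (y i) (y' j) - mdist Y (y i) (y' i)) + \<phi> j"
    using potential_exists[OF assms(1), of "\<lambda>i j. mdist Y (y i) (y' j) - mdist Y (y i) (y' i)"] opt
    by (auto simp: sum_subtractf)
  define g where "g x = Min ((\<lambda>j. \<phi> j + mdist Y x (y' j)) ` S)" for x
  have g_le: "g x \<le> \<phi> j + mdist Y x (y' j)" if "j \<in> S" for x j
    using assms(1) that by (simp add: g_def)
  have le_g: "c \<le> g x" if "\<And>j. j \<in> S \<Longrightarrow> c \<le> \<phi> j + mdist Y x (y' j)" for c x
    using assms(1,2) that by (simp add: g_def)
  \<comment> \<open>A minimum of functions that are 1-Lipschitz by the triangle inequality;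
    exchanging \<open>a\<close> and \<open>b\<close> gives the other side.\<close>
  have half: "g a - mdist Y a b \<le> g b" if ab: "a \<in> mspace Y" "b \<in> mspace Y" for a b
  proof (rule le_g)
    fix j assume j: "j \<in> S"
    show "g a - mdist Y a b \<le> \<phi> j + mdist Y b (y' j)"
      using g_le[OF j, of a] mdist_triangle[OF ab y'[OF j]] by simp
  qed
  have "\<bar>g a - g b\<bar> \<le> mdist Y a b" if ab: "a \<in> mspace Y" "b \<in> mspace Y" for a b
    using half[OF ab] half[OF ab(2,1)] mdist_commute[of Y a b] by simp
  moreover have "mdist Y (y i) (y' i) \<le> g (y i) - g (y' i)" if i: "i \<in> S" for i
  proof -
    have "\<phi> i + mdist Y (y i) (y' i) \<le> g (y i)"
    proof (rule le_g)
      fix j assume "j \<in> S"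
      then show "\<phi> i + mdist Y (y i) (y' i) \<le> \<phi> j + mdist Y (y i) (y' j)"
        using \<phi>[OF i] by fastforce
    qed
    \<comment> \<open>The index \<open>j = i\<close> in the minimum contributes \<phi>
      \<open>i\<close> plus a zero distance.\<close>
    moreover have "g (y' i) \<le> \<phi> i" using g_le[OF i, of "y' i"] mdist_zero[OF y'[OF i] y'[OF i]] by simp
    ultimately show ?thesis by simp
  qed
  ultimately show ?thesis by (rule that)
qed

section \<open>Passage to classes and the dual norm\<close>

lemma Lip0_unit_ballI:
  assumes "\<And>a b. a \<in> mspace Y \<Longrightarrow> b \<in> mspace Y \<Longrightarrow> \<bar>u a - u b\<bar> \<le> mdist Y a b"
    and "u y0 = 0" "\<And>x. x \<notin> mspace Y \<Longrightarrow> u x = 0"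
  shows "u \<in> Lip0 Y y0" "Lip_const Y u \<le> 1"
proof -
  show "u \<in> Lip0 Y y0"
    using assms by (auto simp: Lip0_def Lipschitz_continuous_map_def dist_real_def intro!: exI[of _ 1])
  show "Lip_const Y u \<le> 1"
    unfolding Lip_const_def using assms(1) by (intro cInf_lower bdd_belowI[of _ 0]) auto
qed

text \<open>The bound holds for every choice of representatives; optimal ones turn its right-hand
  side into \<open>G1\<close>.\<close>

lemma zeta_diff_le:
  assumes u: "u \<in> Lip0 Y y0" "Lip_const Y u \<le> 1" and y: "y \<in> tuples Q Y" "y' \<in> tuples Q Y"
  shows "\<bar>(zeta Q (perm_rel Q Y `` {y}) - zeta Q (perm_rel Q Y `` {y'})) u\<bar>
    \<le> (\<Sum>i=1..Q. mdist Y (y i) (y' i))"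
proof -
  have "\<bar>(zeta Q (perm_rel Q Y `` {y}) - zeta Q (perm_rel Q Y `` {y'})) u\<bar>
      = \<bar>\<Sum>i=1..Q. u (y i) - u (y' i)\<bar>"
    by (simp add: y zeta_class sum_subtractf)
  also have "\<dots> \<le> (\<Sum>i=1..Q. \<bar>u (y i) - u (y' i)\<bar>)" by (rule sum_abs)
  also have "\<dots> \<le> (\<Sum>i=1..Q. mdist Y (y i) (y' i))"
    using y by (intro sum_mono Lip0_bound[OF u]) (auto simp: tuples_def PiE_iff)
  finally show ?thesis .
qed

text \<open>An optimal permutation is absorbed into the representative of \<open>v'\<close>, making
  the identity optimal as \<open>matching_potential\<close> requires.\<close>

lemma G1_optimal_representatives:
  assumes "v \<in> unordered_tuples Q Y" "v' \<in> unordered_tuples Q Y"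
  obtains y y' where "y \<in> tuples Q Y" "y' \<in> tuples Q Y"
    "v = perm_rel Q Y `` {y}" "v' = perm_rel Q Y `` {y'}"
    "G1 Q Y v v' = (\<Sum>i=1..Q. mdist Y (y i) (y' i))"
    "\<And>\<sigma>. \<sigma> permutes {1..Q} \<Longrightarrow> G1 Q Y v v' \<le> (\<Sum>i=1..Q. mdist Y (y i) (y' (\<sigma> i)))"
proof -
  obtain y z where y: "y \<in> tuples Q Y" "v = perm_rel Q Y `` {y}"
    and z: "z \<in> tuples Q Y" "v' = perm_rel Q Y `` {z}"
    using assms by (auto simp: unordered_tuples_def quotient_def)
  let ?M = "\<lambda>\<sigma>. \<Sum>i=1..Q. mdist Y (y i) (z (\<sigma> i))"
  have G: "G1 Q Y v v' = Min (?M ` {\<sigma>. \<sigma> permutes {1..Q}})"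
    using G1_class[OF y(1) z(1)] by (simp add: y z image_Collect)
  have fin: "finite (?M ` {\<sigma>. \<sigma> permutes {1..Q}})" by (simp add: finite_permutations)
  have "?M id \<in> ?M ` {\<sigma>. \<sigma> permutes {1..Q}}" using permutes_id by blast
  then have "G1 Q Y v v' \<in> ?M ` {\<sigma>. \<sigma> permutes {1..Q}}"
    unfolding G using fin by (intro Min_in) auto
  then obtain \<tau> where t: "\<tau> permutes {1..Q}" "G1 Q Y v v' = ?M \<tau>" by blast
  show ?thesis
  proof (rule that[OF y(1) tuples_comp[OF z(1) t(1)] y(2)])
    have "(z, z \<circ> \<tau>) \<in> perm_rel Q Y"
      using z t tuples_comp[OF z(1) t(1)] by (auto simp: perm_rel_def)
    then show "v' = perm_rel Q Y `` {z \<circ> \<tau>}"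
      using equiv_class_eq[OF equiv_perm_rel] z(2) by metis
    show "G1 Q Y v v' = (\<Sum>i=1..Q. mdist Y (y i) ((z \<circ> \<tau>) i))" using t by simp
    fix \<sigma> assume "\<sigma> permutes {1..Q}"
    then have "?M (\<tau> \<circ> \<sigma>) \<in> ?M ` {\<sigma>. \<sigma> permutes {1..Q}}"
      using permutes_compose t(1) by blast
    then show "G1 Q Y v v' \<le> (\<Sum>i=1..Q. mdist Y (y i) ((z \<circ> \<tau>) (\<sigma> i)))"
      unfolding G using Min_le[OF fin] by fastforce
  qed
qed

text \<open>For optimal representatives, the potential is a test function attaining the matching
  cost, and \<open>zeta_diff_le\<close> shows that no test function exceeds it.\<close>

theorem Lip_dual_norm_eq_G1:
  assumes "1 \<le> Q" "y0 \<in> mspace Y" and v: "v \<in> unordered_tuples Q Y" "v' \<in> unordered_tuples Q Y"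
  shows "Lip_dual_norm Y y0 (zeta Q v - zeta Q v') = G1 Q Y v v'"
proof -
  obtain y y' where y: "y \<in> tuples Q Y" "y' \<in> tuples Q Y"
    and vy: "v = perm_rel Q Y `` {y}" "v' = perm_rel Q Y `` {y'}"
    and G: "G1 Q Y v v' = (\<Sum>i=1..Q. mdist Y (y i) (y' i))"
    and opt: "\<And>\<sigma>. \<sigma> permutes {1..Q} \<Longrightarrow> G1 Q Y v v' \<le> (\<Sum>i=1..Q. mdist Y (y i) (y' (\<sigma> i)))"
    using G1_optimal_representatives[OF v] by blast
  have mem: "y i \<in> mspace Y" "y' i \<in> mspace Y" if "i \<in> {1..Q}" for i
    using y that by (auto simp: tuples_def PiE_iff)
  obtain g where lip: "\<And>a b. a \<in> mspace Y \<Longrightarrow> b \<in> mspace Y \<Longrightarrow> \<bar>g a - g b\<bar> \<le> mdist Y a b"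
    and drop: "\<And>i. i \<in> {1..Q} \<Longrightarrow> mdist Y (y i) (y' i) \<le> g (y i) - g (y' i)"
    using matching_potential[of "{1..Q}" y Y y'] mem opt assms(1) unfolding G by auto
  \<comment> \<open>Normalised to vanish at \<open>y0\<close> and extended by zero as
    \<open>Lip0\<close> demands; differences at points of \<open>Y\<close> are those of
    \<open>g\<close>.\<close>
  define u where "u x = (if x \<in> mspace Y then g x - g y0 else 0)" for x
  have u: "u \<in> Lip0 Y y0" "Lip_const Y u \<le> 1"
    using Lip0_unit_ballI[of Y u y0] lip by (auto simp: u_def)
  have "G1 Q Y v v' \<le> (\<Sum>i=1..Q. u (y i) - u (y' i))"
    unfolding G using drop mem by (intro sum_mono) (simp add: u_def)
  also have "\<dots> = (zeta Q v - zeta Q v') u"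
    by (simp add: vy y zeta_class sum_subtractf)
  finally have "G1 Q Y v v' \<le> \<bar>(zeta Q v - zeta Q v') u\<bar>" by simp
  also have "\<dots> \<le> Lip_dual_norm Y y0 (zeta Q v - zeta Q v')"
    unfolding Lip_dual_norm_def using u by (intro cSup_upper bdd_above_zeta_diff v) blast
  finally have "G1 Q Y v v' \<le> Lip_dual_norm Y y0 (zeta Q v - zeta Q v')" .
  moreover have "Lip_dual_norm Y y0 (zeta Q v - zeta Q v') \<le> G1 Q Y v v'"
    unfolding Lip_dual_norm_def
  proof (rule cSup_least)
    show "{\<bar>(zeta Q v - zeta Q v') u\<bar> | u. u \<in> Lip0 Y y0 \<and> Lip_const Y u \<le> 1} \<noteq> {}"
      using u by blast
  qed (use zeta_diff_le[OF _ _ y] G vy in auto)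
  ultimately show ?thesis by simp
qed

section \<open>Bounds on the chosen constant\<close>

lemma G1_nonneg:
  assumes "v \<in> unordered_tuples Q Y" "v' \<in> unordered_tuples Q Y"
  shows "0 \<le> G1 Q Y v v'"
  using G1_optimal_representatives[OF assms] by (metis mdist_nonneg sum_nonneg)

lemma G1_const_tuples:
  assumes "a \<in> mspace Y" "b \<in> mspace Y"
  shows "G1 Q Y (perm_rel Q Y `` {\<lambda>i\<in>{1..Q}. a}) (perm_rel Q Y `` {\<lambda>i\<in>{1..Q}. b}) = Q * mdist Y a b"
proof -
  have tup: "(\<lambda>i\<in>{1..Q}. a) \<in> tuples Q Y" "(\<lambda>i\<in>{1..Q}. b) \<in> tuples Q Y"
    using assms by (auto simp: tuples_def)
  have "(\<Sum>i=1..Q. mdist Y ((\<lambda>i\<in>{1..Q}. a) i) ((\<lambda>i\<in>{1..Q}. b) (\<sigma> i))) = Q * mdist Y a b"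
    if "\<sigma> permutes {1..Q}" for \<sigma>
  proof -
    have "(\<Sum>i=1..Q. mdist Y ((\<lambda>i\<in>{1..Q}. a) i) ((\<lambda>i\<in>{1..Q}. b) (\<sigma> i))) = (\<Sum>i=1..Q. mdist Y a b)"
      by (rule sum.cong) (simp_all only: permutes_in_image[OF that] restrict_apply if_True)
    then show ?thesis by simp
  qed
  then have "{\<Sum>i=1..Q. mdist Y ((\<lambda>i\<in>{1..Q}. a) i) ((\<lambda>i\<in>{1..Q}. b) (\<sigma> i)) | \<sigma>. \<sigma> permutes {1..Q}}
      = {Q * mdist Y a b}"
    using permutes_id[of "{1..Q}"] by (auto intro!: exI[of _ id])
  then show ?thesis by (simp only: G1_class[OF tup] Min_singleton)
qed

text \<open>By duality over \<open>nat\<close> the constant 1 is admissible, so the choice operator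
  returns an admissible value. One pair at positive distance then forces it to be at most 1.\<close>

lemma c_const_bounds:
  assumes "1 \<le> Q"
  shows "0 < c_const Q" "c_const Q \<le> 1"
proof -
  have ex: "\<exists>c. 0 < c \<and>
     (\<forall>(Y :: nat metric) y0 v v'.
        y0 \<in> mspace Y \<longrightarrow> v \<in> unordered_tuples Q Y \<longrightarrow> v' \<in> unordered_tuples Q Y \<longrightarrow>
          c * G1 Q Y v v' \<le> Lip_dual_norm Y y0 (zeta Q v - zeta Q v') \<and>
          Lip_dual_norm Y y0 (zeta Q v - zeta Q v') \<le> G1 Q Y v v')"
    by (rule exI[of _ 1]) (simp add: Lip_dual_norm_eq_G1[OF assms])
  note c = someI_ex[OF ex, folded c_const_def]
  show "0 < c_const Q" using c by blast
  \<comment> \<open>In the discrete metric the constant tuples at 0 and 1 have distance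
    \<open>Q\<close>, which is positive and can be cancelled.\<close>
  define Y where "Y = metric (UNIV :: nat set, discrete_metric.dd)"
  have Y: "mspace Y = UNIV" "mdist Y a b = (if a = b then 0 else 1)" for a b
    by (simp_all add: Y_def Metric_space.mspace_metric[OF metric_M_dd]
        Metric_space.mdist_metric[OF metric_M_dd]) (simp_all add: discrete_metric.dd_def)
  define v where "v a = perm_rel Q Y `` {\<lambda>i\<in>{1..Q}. a}" for a
  have v: "v a \<in> unordered_tuples Q Y" for a
    by (auto simp: v_def unordered_tuples_def tuples_def Y intro!: quotientI)
  have "G1 Q Y (v 0) (v 1) = Q"
    unfolding v_def by (subst G1_const_tuples) (auto simp: Y)
  moreover have "c_const Q * G1 Q Y (v 0) (v 1) \<le> G1 Q Y (v 0) (v 1)"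
    using c v[of 0] v[of 1] by (metis (no_types, lifting) UNIV_I Y(1) order_trans)
  ultimately show "c_const Q \<le> 1" using assms by simp
qed

theorem theorem3p4p1:
  fixes Q :: nat
  assumes "1 \<le> Q"
  shows "0 < c_const Q \<and>
    (\<forall>(Y :: 'a metric) y0 v v'.
       y0 \<in> mspace Y \<longrightarrow> v \<in> unordered_tuples Q Y \<longrightarrow> v' \<in> unordered_tuples Q Y \<longrightarrow>
         c_const Q * G1 Q Y v v' \<le> Lip_dual_norm Y y0 (zeta Q v - zeta Q v') \<and>
         Lip_dual_norm Y y0 (zeta Q v - zeta Q v') \<le> G1 Q Y v v')"
proof (intro conjI allI impI)
  show "0 < c_const Q" by (rule c_const_bounds[OF assms])
next
  fix Y :: "'a metric" and y0 v v'
  assume hyps: "y0 \<in> mspace Y" "v \<in> unordered_tuples Q Y" "v' \<in> unordered_tuples Q Y"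
  \<comment> \<open>Duality holds over every point type, so only the bounds on
    \<open>c_const\<close> are taken from the metrics on \<open>nat\<close>.\<close>
  note eq = Lip_dual_norm_eq_G1[OF assms hyps]
  show "c_const Q * G1 Q Y v v' \<le> Lip_dual_norm Y y0 (zeta Q v - zeta Q v')"
    using mult_right_mono[OF c_const_bounds(2)[OF assms] G1_nonneg[OF hyps(2,3)]] by (simp add: eq)
  show "Lip_dual_norm Y y0 (zeta Q v - zeta Q v') \<le> G1 Q Y v v'" by (simp add: eq)
qed

end
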